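(* Let $E$ be an elliptic curve with complex multiplication by the ring $R=\operatorname{End}(E)$, let $\omega,\omega'\in R$ with $\omega'\neq0$, and let $n\ge0$ and $k>0$ be integers. Let $\Delta=\{(P,P):P\in E\}\subsetneq E\times E$ and $\Delta'=\{(P,P):P\in\mathbb{P}^1\}\subsetneq\mathbb{P}^1\times\mathbb{P}^1$. (1) If $(\omega/\omega')^k=-1$, then $\Delta'$ is pre-periodic with pair $(n,k)$ for $\varphi_{[\omega]}\times\varphi_{[\omega']}$, but $\Delta$ is not pre-periodic with pair $(n,k)$ for $[\omega]\times[\omega']$. (2) If $(\omega/\omega')^k=1$, then $\Delta$ is pre-periodic with pair $(n,k)$ for $[\omega]\times[\omega']$ and $\Delta'$ is pre-periodic with the same pair $(n,k)$ for $\varphi_{[\omega]}\times\varphi_{[\omega']}$.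
   Context: The base field is algebraically closed of characteristic $0$; "complex multiplication" means that $R=\operatorname{End}(E)$ is strictly larger than $\mathbb{Z}$ (so $R$ is an order in an imaginary quadratic field). The quotient $\omega/\omega'$ is taken in the fraction field of $R$. For $\omega\in R$, $[\omega]:E\to E$ denotes the corresponding endomorphism. Let $\pi:E\to E/\{\pm1\}\cong\mathbb{P}^1$ be the quotient map by the hyperelliptic involution $P\mapsto -P$; $\varphi_{[\omega]}:\mathbb{P}^1\to\mathbb{P}^1$ is the unique morphism with $\varphi_{[\omega]}\circ\pi=\pi\circ[\omega]$. The maps $[\omega]\times[\omega']:E\times E\to E\times E$ and $\varphi_{[\omega]}\times\varphi_{[\omega']}:\mathbb{P}^1\times\mathbb{P}^1\to\mathbb{P}^1\times\mathbb{P}^1$ act coordinatewise. For a self-map $\varphi:X\to X$ of a projective variety and integers $n\ge0$, $k>0$, a subvariety $Y\subsetneq X$ is pre-periodic with pair $(n,k)$ for $\varphi$ if $\varphi^{n+k}(Y)=\varphi^{n}(Y)$, where $\varphi^m(Y)$ denotes the image of $Y$ under the $m$-th iterate of $\varphi$ (no minimality of $n$ or $k$ is required). *)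

theory Defs
  imports
    "HOL-Analysis.Cartesian_Space"
    "HOL-Computational_Algebra.Polynomial"
    "HOL-Algebra.Ring"
begin

section \<open>Projective space and morphisms\<close>

definition proj_rel :: "'k::field ^ 'n \<Rightarrow> 'k ^ 'n \<Rightarrow> bool" where
  "proj_rel u v \<longleftrightarrow> u \<noteq> 0 \<and> v \<noteq> 0 \<and> (\<exists>c. c \<noteq> 0 \<and> v = c *s u)"

lemma part_equivp_proj_rel: "part_equivp (proj_rel :: 'k::field ^ 'n \<Rightarrow> 'k ^ 'n \<Rightarrow> bool)"
proof (rule part_equivpI)
  have "proj_rel ((\<chi> i. 1) :: 'k ^ 'n) (\<chi> i. 1)"
    unfolding proj_rel_def by (auto simp: vec_eq_iff intro!: exI[of _ 1])
  then show "\<exists>x::'k ^ 'n. proj_rel x x" by blast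
  show "symp (proj_rel :: 'k ^ 'n \<Rightarrow> 'k ^ 'n \<Rightarrow> bool)"
  proof (rule sympI)
    fix u v :: "'k ^ 'n"
    assume "proj_rel u v"
    then obtain c where c: "u \<noteq> 0" "v \<noteq> 0" "c \<noteq> 0" "v = c *s u"
      unfolding proj_rel_def by blast
    then have "u = inverse c *s v" by (simp add: vec_eq_iff)
    with c show "proj_rel v u"
      unfolding proj_rel_def using nonzero_imp_inverse_nonzero by blast
  qed
  show "transp (proj_rel :: 'k ^ 'n \<Rightarrow> 'k ^ 'n \<Rightarrow> bool)"
    unfolding transp_def proj_rel_def
    by (metis mult_eq_0_iff vector_smult_assoc)
qed

text \<open>\<open>('k, 'n) proj\<close> is the projective space of dimension \<open>CARD('n) - 1\<close>;
  \<open>abs_proj v\<close> is meaningful only for \<open>v \<noteq> 0\<close>, and \<open>rep_proj P\<close> is an unspecified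
  choice of homogeneous coordinates of \<open>P\<close>.\<close>

quotient_type (overloaded) ('k, 'n) proj = "'k::field ^ 'n" / partial: proj_rel
  by (rule part_equivp_proj_rel)

inductive form :: "nat \<Rightarrow> ('k::field ^ 'n \<Rightarrow> 'k) \<Rightarrow> bool" where
  const: "form 0 (\<lambda>v. c)"
| coord: "form 1 (\<lambda>v. v $ i)"
| add: "form d F \<Longrightarrow> form d G \<Longrightarrow> form d (\<lambda>v. F v + G v)"
| mult: "form d F \<Longrightarrow> form e G \<Longrightarrow> form (d + e) (\<lambda>v. F v * G v)"

text \<open>Near every point a morphism is given by forms of one common degree without a common
  zero there; the values on the whole of the resulting Zariski open subset of \<open>X\<close> are prescribed.\<close>

definition morphism ::
  "('k::field, 'm::finite) proj set \<Rightarrow> ('k, 'n::finite) proj set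
    \<Rightarrow> (('k, 'm) proj \<Rightarrow> ('k, 'n) proj) \<Rightarrow> bool" where
  "morphism X Y f \<longleftrightarrow> f \<in> X \<rightarrow> Y \<and>
     (\<forall>P\<in>X. \<exists>d F. (\<forall>i. form d (F i)) \<and> (\<exists>i. F i (rep_proj P) \<noteq> 0) \<and>
        (\<forall>Q\<in>X. (\<exists>i. F i (rep_proj Q) \<noteq> 0) \<longrightarrow>
           f Q = abs_proj (\<chi> i. F i (rep_proj Q))))"

section \<open>Elliptic curves\<close>

text \<open>In characteristic \<open>0\<close> every elliptic curve is a smooth plane cubic
  \<open>y\<^sup>2 z = x\<^sup>3 + a x z\<^sup>2 + b z\<^sup>3\<close> with origin \<open>[0 : 1 : 0]\<close>.\<close>

definition elliptic_curve :: "'k::field \<Rightarrow> 'k \<Rightarrow> bool" where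
  "elliptic_curve a b \<longleftrightarrow> 4 * a ^ 3 + 27 * b ^ 2 \<noteq> 0"

definition curve :: "'k::field \<Rightarrow> 'k \<Rightarrow> ('k, 3) proj set" where
  "curve a b = {P. let v = rep_proj P in
     (v $ 2)\<^sup>2 * v $ 3 = (v $ 1) ^ 3 + a * v $ 1 * (v $ 3)\<^sup>2 + b * (v $ 3) ^ 3}"

definition origin :: "('k::field, 3) proj" where
  "origin = abs_proj (vector [0, 1, 0])"

definition affine_pt :: "'k::field \<Rightarrow> 'k \<Rightarrow> ('k, 3) proj" where
  "affine_pt x y = abs_proj (vector [x, y, 1])"

definition xcoord :: "('k::field, 3) proj \<Rightarrow> 'k" where
  "xcoord P = rep_proj P $ 1 / rep_proj P $ 3"

definition ycoord :: "('k::field, 3) proj \<Rightarrow> 'k" where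
  "ycoord P = rep_proj P $ 2 / rep_proj P $ 3"

text \<open>Chord-tangent law; \<open>m\<close> is the slope of the line through \<open>P\<close> and \<open>Q\<close>
  (of the tangent if \<open>P = Q\<close>).\<close>

definition ec_add :: "'k::field \<Rightarrow> ('k, 3) proj \<Rightarrow> ('k, 3) proj \<Rightarrow> ('k, 3) proj" where
  "ec_add a P Q =
    (if P = origin then Q
     else if Q = origin then P
     else let x1 = xcoord P; y1 = ycoord P; x2 = xcoord Q; y2 = ycoord Q in
       if x1 = x2 \<and> y1 = - y2 then origin
       else let m = (if x1 = x2 then (3 * x1\<^sup>2 + a) / (2 * y1) else (y2 - y1) / (x2 - x1));
                x3 = m\<^sup>2 - x1 - x2
            in affine_pt x3 (m * (x1 - x3) - y1))"

definition curve_group :: "'k::field \<Rightarrow> 'k \<Rightarrow> ('k, 3) proj monoid" where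
  "curve_group a b = \<lparr>carrier = curve a b, monoid.mult = ec_add a, one = origin\<rparr>"

text \<open>Endomorphisms are the morphisms of varieties that are group homomorphisms. They are
  represented by functions that are \<open>undefined\<close> off the curve, so that equality in the
  ring is equality of maps on the curve.\<close>

definition End_ring :: "'k::field \<Rightarrow> 'k \<Rightarrow> (('k, 3) proj \<Rightarrow> ('k, 3) proj) ring" where
  "End_ring a b =
    \<lparr>carrier = {f \<in> extensional (curve a b).
        morphism (curve a b) (curve a b) f \<and> f \<in> hom (curve_group a b) (curve_group a b)},
     monoid.mult = (\<lambda>f g. compose (curve a b) f g),
     one = (\<lambda>P\<in>curve a b. P),
     zero = (\<lambda>P\<in>curve a b. origin),
     add = (\<lambda>f g. \<lambda>P\<in>curve a b. ec_add a (f P) (g P))\<rparr>"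

definition has_CM :: "'k::field \<Rightarrow> 'k \<Rightarrow> bool" where
  "has_CM a b \<longleftrightarrow>
    (\<exists>f \<in> carrier (End_ring a b). \<forall>m::int. f \<noteq> [m] \<cdot>\<^bsub>End_ring a b\<^esub> \<one>\<^bsub>End_ring a b\<^esub>)"

definition is_fraction_field ::
  "('r, 'u) ring_scheme \<Rightarrow> ('f, 'v) ring_scheme \<Rightarrow> ('r \<Rightarrow> 'f) \<Rightarrow> bool" where
  "is_fraction_field R F \<iota> \<longleftrightarrow>
     field F \<and> \<iota> \<in> ring_hom R F \<and> inj_on \<iota> (carrier R) \<and>
     (\<forall>x \<in> carrier F. \<exists>r \<in> carrier R. \<exists>s \<in> carrier R - {\<zero>\<^bsub>R\<^esub>}. x = \<iota> r \<otimes>\<^bsub>F\<^esub> inv\<^bsub>F\<^esub> \<iota> s)"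

section \<open>The hyperelliptic quotient\<close>

text \<open>The quotient \<open>E \<rightarrow> E/{\<plusminus>1} \<cong> P\<^sup>1\<close> is the \<open>x\<close>-coordinate, whose value at the
  origin is \<open>[1 : 0]\<close>; lemmas \<open>pi_eq_iff\<close> and \<open>pi_surj\<close> below confirm that its fibres are the
  orbits of the involution.\<close>

definition pi_map :: "('k::field, 3) proj \<Rightarrow> ('k, 2) proj" where
  "pi_map P = (if P = origin then abs_proj (vector [1, 0])
               else abs_proj (vector [rep_proj P $ 1, rep_proj P $ 3]))"

text \<open>At most one \<open>\<phi>\<close> satisfies the following condition (\<open>induced_on_P1_unique\<close> below).\<close>

definition induced_on_P1 ::
  "'k::field \<Rightarrow> 'k \<Rightarrow> (('k, 3) proj \<Rightarrow> ('k, 3) proj) \<Rightarrow> (('k, 2) proj \<Rightarrow> ('k, 2) proj) \<Rightarrow> bool" where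
  "induced_on_P1 a b \<omega> \<phi> \<longleftrightarrow>
     morphism UNIV UNIV \<phi> \<and> (\<forall>P \<in> curve a b. \<phi> (pi_map P) = pi_map (\<omega> P))"

section \<open>Pre-periodic subvarieties\<close>

text \<open>Subvarieties are identified with their sets of points over the algebraically closed
  base field; the image of a subvariety is then the image of a set.
  The two diagonals are proper subsets of the ambient surfaces (\<open>diagonal_curve_psubset\<close>,
  \<open>diagonal_P1_psubset\<close> below).\<close>

definition preperiodic :: "('x \<Rightarrow> 'x) \<Rightarrow> nat \<Rightarrow> nat \<Rightarrow> 'x set \<Rightarrow> bool" where
  "preperiodic \<phi> n k Y \<longleftrightarrow> (\<phi> ^^ (n + k)) ` Y = (\<phi> ^^ n) ` Y"

definition diagonal :: "'x set \<Rightarrow> ('x \<times> 'x) set" where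
  "diagonal X = {(P, P) | P. P \<in> X}"

section \<open>Basic facts\<close>

lemma rep_proj_nonzero: "rep_proj P \<noteq> 0"
  using Quotient3_rep_reflp[OF Quotient3_proj, of P] by (simp add: proj_rel_def)

lemma abs_rep_proj [simp]: "abs_proj (rep_proj P) = P"
  using Quotient3_abs_rep[OF Quotient3_proj] .

lemma abs_proj_eq_iff:
  assumes "u \<noteq> 0" "v \<noteq> 0"
  shows "abs_proj u = abs_proj v \<longleftrightarrow> (\<exists>c. c \<noteq> 0 \<and> v = c *s u)"
proof -
  have r: "proj_rel w w" if "w \<noteq> 0" for w :: "'a ^ 'b"
    using that unfolding proj_rel_def by (auto simp: vec_eq_iff intro!: exI[of _ 1])
  show ?thesis
    using Quotient3_rel[OF Quotient3_proj, of u v] r[OF assms(1)] r[OF assms(2)] assms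
    by (simp add: proj_rel_def)
qed

lemma rep_abs_proj:
  assumes "v \<noteq> 0"
  obtains c where "c \<noteq> 0" "rep_proj (abs_proj v) = c *s v"
  using abs_proj_eq_iff[OF assms rep_proj_nonzero[of "abs_proj v"]] by auto

definition ec_neg :: "('k::field, 3) proj \<Rightarrow> ('k, 3) proj" where
  "ec_neg P = abs_proj (vector [rep_proj P $ 1, - rep_proj P $ 2, rep_proj P $ 3])"

lemma rep_affine_pt:
  obtains c where "c \<noteq> 0" "rep_proj (affine_pt x y) = vector [c * x, c * y, c]"
proof -
  have "(vector [x, y, 1] :: 'a ^ 3) \<noteq> 0" by (auto simp: vec_eq_iff forall_3)
  then obtain c where "c \<noteq> 0" "rep_proj (affine_pt x y) = c *s vector [x, y, 1]"
    unfolding affine_pt_def by (rule rep_abs_proj)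
  then show thesis using that[of c] by (simp add: vec_eq_iff forall_3)
qed

lemma rep_origin:
  obtains c where "c \<noteq> 0" "rep_proj origin = vector [0, c, 0]"
proof -
  have "(vector [0, 1, 0] :: 'a ^ 3) \<noteq> 0" by (auto simp: vec_eq_iff forall_3)
  then obtain c :: 'a where "c \<noteq> 0" "rep_proj origin = c *s vector [0, 1, 0]"
    unfolding origin_def by (rule rep_abs_proj)
  then show thesis using that[of c] by (simp add: vec_eq_iff forall_3)
qed

lemma xcoord_affine_pt [simp]: "xcoord (affine_pt x y) = x"
  by (rule rep_affine_pt[of x y]) (simp add: xcoord_def)

lemma ycoord_affine_pt [simp]: "ycoord (affine_pt x y) = y"
  by (rule rep_affine_pt[of x y]) (simp add: ycoord_def)

lemma affine_pt_eq_iff [simp]: "affine_pt x y = affine_pt x' y' \<longleftrightarrow> x = x' \<and> y = y'"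
  by (metis xcoord_affine_pt ycoord_affine_pt)

lemma affine_pt_neq_origin [simp]: "affine_pt x y \<noteq> origin" "origin \<noteq> affine_pt x y"
proof -
  obtain c where c: "c \<noteq> 0" "rep_proj (affine_pt x y) = vector [c * x, c * y, c]"
    by (rule rep_affine_pt)
  obtain d :: 'a where d: "d \<noteq> 0" "rep_proj origin = vector [0, d, 0]"
    by (rule rep_origin)
  show "affine_pt x y \<noteq> origin" using c d by (metis vector_3(3))
  then show "origin \<noteq> affine_pt x y" by metis
qed

lemma origin_in_curve: "origin \<in> curve a b"
proof -
  obtain d :: 'a where "d \<noteq> 0" "rep_proj origin = vector [0, d, 0]"
    by (rule rep_origin)
  then show ?thesis by (simp add: curve_def)
qed

lemma affine_pt_in_curve: "affine_pt x y \<in> curve a b \<longleftrightarrow> y\<^sup>2 = x ^ 3 + a * x + b"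
proof -
  obtain c where c: "c \<noteq> 0" "rep_proj (affine_pt x y) = vector [c * x, c * y, c]"
    by (rule rep_affine_pt)
  have "affine_pt x y \<in> curve a b \<longleftrightarrow> c ^ 3 * y\<^sup>2 = c ^ 3 * (x ^ 3 + a * x + b)"
    using c by (simp add: curve_def power2_eq_square power3_eq_cube algebra_simps)
  with c show ?thesis by simp
qed

lemma curve_cases:
  assumes "P \<in> curve a b"
  obtains "P = origin" | x y where "P = affine_pt x y" "y\<^sup>2 = x ^ 3 + a * x + b"
proof (cases "rep_proj P $ 3 = 0")
  case True
  with assms have "rep_proj P $ 1 = 0" by (simp add: curve_def)
  with True have "rep_proj P = rep_proj P $ 2 *s vector [0, 1, 0]"
    by (simp add: vec_eq_iff forall_3)
  moreover from this have "rep_proj P $ 2 \<noteq> 0"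
    using rep_proj_nonzero[of P] by (metis vector_smult_lzero)
  moreover have "(vector [0, 1, 0] :: 'a ^ 3) \<noteq> 0" by (auto simp: vec_eq_iff forall_3)
  ultimately have "abs_proj (vector [0, 1, 0]) = abs_proj (rep_proj P)"
    using abs_proj_eq_iff rep_proj_nonzero by blast
  with that(1) show thesis by (simp add: origin_def)
next
  case False
  have "rep_proj P = rep_proj P $ 3 *s vector [xcoord P, ycoord P, 1]"
    using False by (simp add: vec_eq_iff forall_3 xcoord_def ycoord_def)
  moreover have "(vector [xcoord P, ycoord P, 1] :: 'a ^ 3) \<noteq> 0"
    by (auto simp: vec_eq_iff forall_3)
  ultimately have "abs_proj (vector [xcoord P, ycoord P, 1]) = abs_proj (rep_proj P)"
    using abs_proj_eq_iff rep_proj_nonzero False by blast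
  then have P: "P = affine_pt (xcoord P) (ycoord P)" by (simp add: affine_pt_def)
  with assms that(2) show thesis using affine_pt_in_curve by metis
qed

lemma pi_origin [simp]: "pi_map origin = abs_proj (vector [1, 0])"
  by (simp add: pi_map_def)

lemma pi_affine_pt [simp]: "pi_map (affine_pt x y) = abs_proj (vector [x, 1])"
proof -
  obtain c where c: "c \<noteq> 0" "rep_proj (affine_pt x y) = vector [c * x, c * y, c]"
    by (rule rep_affine_pt)
  have "abs_proj (vector [x, 1] :: 'a ^ 2) = abs_proj (vector [c * x, c])"
    using c(1) by (subst abs_proj_eq_iff) (auto simp: vec_eq_iff forall_2)
  with c show ?thesis by (simp add: pi_map_def)
qed

lemma ec_neg_origin [simp]: "ec_neg origin = origin"
proof -
  obtain d :: 'a where d: "d \<noteq> 0" "rep_proj origin = vector [0, d, 0]"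
    by (rule rep_origin)
  have "abs_proj (vector [0, 1, 0] :: 'a ^ 3) = abs_proj (vector [0, - d, 0])"
    using d(1) by (subst abs_proj_eq_iff) (auto simp: vec_eq_iff forall_3 intro!: exI[of _ "- d"])
  with d show ?thesis by (simp add: ec_neg_def origin_def)
qed

lemma ec_neg_affine_pt [simp]: "ec_neg (affine_pt x y) = affine_pt x (- y)"
proof -
  obtain c where c: "c \<noteq> 0" "rep_proj (affine_pt x y) = vector [c * x, c * y, c]"
    by (rule rep_affine_pt)
  have "abs_proj (vector [x, - y, 1] :: 'a ^ 3) = abs_proj (vector [c * x, - (c * y), c])"
    using c(1) by (subst abs_proj_eq_iff) (auto simp: vec_eq_iff forall_3)
  with c show ?thesis by (simp add: ec_neg_def affine_pt_def)
qed

lemma ec_add_ec_neg: "P \<in> curve a b \<Longrightarrow> ec_add a P (ec_neg P) = origin"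
  by (erule curve_cases) (auto simp: ec_add_def)

lemma pi_eq_iff:
  assumes "P \<in> curve a b" "Q \<in> curve a b"
  shows "pi_map P = pi_map Q \<longleftrightarrow> Q = P \<or> Q = ec_neg P"
proof -
  have 1: "abs_proj (vector [x, 1]) \<noteq> abs_proj (vector [1, 0] :: 'a ^ 2)" for x
    by (subst abs_proj_eq_iff) (auto simp: vec_eq_iff forall_2)
  have 2: "abs_proj (vector [x, 1] :: 'a ^ 2) = abs_proj (vector [x', 1]) \<longleftrightarrow> x = x'" for x x'
    by (subst abs_proj_eq_iff) (auto simp: vec_eq_iff forall_2)
  have 3: "y = y' \<or> y = - y'" if "y\<^sup>2 = c" "y'\<^sup>2 = c" for y y' c :: 'a
    using that by (metis power2_eq_iff)
  show ?thesis
    using assms(1)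
  proof (cases rule: curve_cases)
    case P: 1
    from assms(2) show ?thesis
      by (cases rule: curve_cases) (use P 1 in \<open>auto dest: sym\<close>)
  next
    case P: (2 x y)
    from assms(2) show ?thesis
    proof (cases rule: curve_cases)
      case Q: 1
      with P 1 show ?thesis by auto
    next
      case Q: (2 x' y')
      with P 2 3[of y "x ^ 3 + a * x + b" y'] show ?thesis by auto
    qed
  qed
qed

lemma pi_surj: "pi_map ` curve a b = (UNIV :: ('k::alg_closed_field, 2) proj set)"
proof -
  have "T \<in> pi_map ` curve a b" for T :: "('k, 2) proj"
  proof (cases "rep_proj T $ 2 = 0")
    case True
    have "abs_proj (vector [1, 0]) = abs_proj (rep_proj T)"
      using rep_proj_nonzero[of T] True
      by (subst abs_proj_eq_iff)
        (auto simp: vec_eq_iff forall_2 intro!: exI[of _ "rep_proj T $ 1"])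
    then have "T = pi_map origin" by simp
    then show ?thesis using origin_in_curve by blast
  next
    case False
    define x where "x = rep_proj T $ 1 / rep_proj T $ 2"
    have "abs_proj (vector [x, 1]) = abs_proj (rep_proj T)"
      using rep_proj_nonzero[of T] False
      by (subst abs_proj_eq_iff)
        (auto simp: vec_eq_iff forall_2 x_def intro!: exI[of _ "rep_proj T $ 2"])
    moreover obtain y where "y\<^sup>2 = x ^ 3 + a * x + b"
      using nth_root_exists[of 2 "x ^ 3 + a * x + b"] by auto
    ultimately have "T = pi_map (affine_pt x y)" "affine_pt x y \<in> curve a b"
      by (simp_all add: affine_pt_in_curve)
    then show ?thesis by blast
  qed
  then show ?thesis by blast
qed

lemma induced_on_P1_unique:
  fixes a b :: "'k::alg_closed_field"
  assumes "induced_on_P1 a b \<omega> \<phi>" "induced_on_P1 a b \<omega> \<psi>"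
  shows "\<phi> = \<psi>"
proof
  fix T
  obtain P where "P \<in> curve a b" "T = pi_map P" using pi_surj[of a b] by blast
  with assms show "\<phi> T = \<psi> T" by (simp add: induced_on_P1_def)
qed

lemma diagonal_curve_psubset:
  "diagonal (curve a b) \<subset> curve a b \<times> (curve a b :: ('k::alg_closed_field, 3) proj set)"
proof -
  obtain y where "y\<^sup>2 = 0 ^ 3 + a * 0 + b"
    using nth_root_exists[of 2 b] by auto
  then have "(origin, affine_pt 0 y) \<in> curve a b \<times> curve a b - diagonal (curve a b)"
    using affine_pt_in_curve[of 0 y a b] origin_in_curve[of a b] by (auto simp: diagonal_def)
  moreover have "diagonal (curve a b) \<subseteq> curve a b \<times> curve a b" by (auto simp: diagonal_def)
  ultimately show ?thesis by blast
qed

lemma diagonal_P1_psubset: "diagonal UNIV \<subset> (UNIV :: (('k::field, 2) proj \<times> ('k, 2) proj) set)"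
proof -
  have "abs_proj (vector [1, 0] :: 'k ^ 2) \<noteq> abs_proj (vector [0, 1])"
    by (subst abs_proj_eq_iff) (auto simp: vec_eq_iff forall_2)
  then have "(abs_proj (vector [1, 0] :: 'k ^ 2), abs_proj (vector [0, 1])) \<notin> diagonal UNIV"
    by (auto simp: diagonal_def)
  then show ?thesis by blast
qed

end

theory Submission
  imports Defs
begin

text \<open>Write \<open>E\<close> for the curve. Passing to the fraction field \<open>F\<close>, where multiplication is
  commutative and \<open>\<iota>\<close> is injective, shows that endomorphisms of \<open>E\<close> commute and turns
  \<open>(\<omega>/\<omega>')\<^sup>k = \<plusminus>1\<close> into the identity \<open>\<omega>\<^sup>k = \<plusminus>\<omega>'\<^sup>k\<close> of maps on \<open>E\<close>
  (lemmas \<open>End_commute\<close> and \<open>End_pow_quotient\<close>).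

  The iterate with exponent \<open>n + k\<close> sends \<open>(P, P)\<close> to \<open>(\<omega>\<^sup>n (\<plusminus>Q), \<omega>'\<^sup>n Q)\<close> with \<open>Q = \<omega>'\<^sup>k P\<close>.
  Since \<open>\<omega>'\<close> is surjective, \<open>Q\<close> runs through all of \<open>E\<close>. For the sign \<open>+\<close> the image is that of
  the iterate with exponent \<open>n\<close>. For the sign \<open>-\<close> the two images agree after the projection to the
  projective line, which forgets the sign of the first coordinate. They do not agree on \<open>E \<times> E\<close>:
  otherwise every \<open>Q\<close> has a partner \<open>Q'\<close> with \<open>\<omega>\<^sup>n (- Q) = \<omega>\<^sup>n Q'\<close> and
  \<open>\<omega>'\<^sup>n Q = \<omega>'\<^sup>n Q'\<close>, so that \<open>T = \<omega>\<^sup>n (\<omega>'\<^sup>n Q)\<close> satisfies \<open>- T = T\<close>; but \<open>T\<close> is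
  an arbitrary point of \<open>E\<close>, because \<open>\<omega>\<close> is surjective as well. The argument never uses
  associativity of the group law, only its closure and its compatibility with negation.

  The geometric input is that a nonzero endomorphism is surjective (\<open>End_surj\<close>). As endomorphisms
  commute with negation, it suffices that the induced map of the projective line is surjective.
  It is not constant, and a morphism from the line to itself is constant or surjective
  (\<open>morphism_proj_line_surj_or_const\<close>): it is given by two polynomials without a common root, and
  if it misses a point, some linear combination of the two has no root and is constant; comparing
  degrees at infinity then forces both polynomials to be constant.\<close>

section \<open>Forms and morphisms\<close>

lemma form_scale: "form d F \<Longrightarrow> F (c *s v) = c ^ d * F v"
  by (induction rule: form.induct) (auto simp: power_add algebra_simps)

lemma form_compose:
  assumes "form e G" "\<And>j. form d (F j)"
  shows "form (e * d) (\<lambda>v. G (\<chi> j. F j v))"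
  using assms(1)
proof (induction rule: form.induct)
  case (const c)
  show ?case using form.const[of c] by simp
next
  case (coord i)
  show ?case using assms(2)[of i] by simp
next
  case (add e G H)
  then show ?case by (intro form.add)
next
  case (mult e G e' H)
  then show ?case using form.mult by (fastforce simp: add_mult_distrib)
qed

lemma morphism_compose:
  assumes f: "morphism X Y f" and g: "morphism Y Z g"
  shows "morphism X Z (compose X g f)"
  unfolding morphism_def
proof (intro conjI ballI)
  have fX: "f Q \<in> Y" if "Q \<in> X" for Q
    using f that by (auto simp: morphism_def)
  then show "compose X g f \<in> X \<rightarrow> Z"
    using g by (auto simp: morphism_def compose_def)
  fix P assume P: "P \<in> X"
  obtain d F where F: "\<And>i. form d (F i)" "\<exists>i. F i (rep_proj P) \<noteq> 0"
    and Ff: "\<And>Q. Q \<in> X \<Longrightarrow> \<exists>i. F i (rep_proj Q) \<noteq> 0 \<Longrightarrow> f Q = abs_proj (\<chi> i. F i (rep_proj Q))"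
    using f P unfolding morphism_def by blast
  obtain e G where G: "\<And>i. form e (G i)" "\<exists>i. G i (rep_proj (f P)) \<noteq> 0"
    and Gg: "\<And>Q. Q \<in> Y \<Longrightarrow> \<exists>i. G i (rep_proj Q) \<noteq> 0 \<Longrightarrow> g Q = abs_proj (\<chi> i. G i (rep_proj Q))"
    using g fX[OF P] unfolding morphism_def by blast
  obtain i0 where i0: "F i0 (rep_proj P) \<noteq> 0" using F(2) by blast
  \<comment> \<open>The factor \<open>F i0\<close> keeps the common zeros of \<open>F\<close> out of the open set even when \<open>G\<close> is constant.\<close>
  define H where "H i v = F i0 v * G i (\<chi> j. F j v)" for i v
  have GF: "\<exists>c. c \<noteq> 0 \<and> (\<forall>i. G i (rep_proj (f Q)) = c * G i (\<chi> j. F j (rep_proj Q)))"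
    if Q: "Q \<in> X" "\<exists>i. F i (rep_proj Q) \<noteq> 0" for Q
  proof -
    have nz: "(\<chi> j. F j (rep_proj Q)) \<noteq> 0"
      using Q(2) by (auto simp: vec_eq_iff)
    then obtain c where "c \<noteq> 0" "rep_proj (f Q) = c *s (\<chi> j. F j (rep_proj Q))"
      unfolding Ff[OF Q] by (rule rep_abs_proj)
    then show ?thesis using form_scale[OF G(1)] by (intro exI[of _ "c ^ e"]) simp
  qed
  show "\<exists>d F. (\<forall>i. form d (F i)) \<and> (\<exists>i. F i (rep_proj P) \<noteq> 0) \<and>
        (\<forall>Q\<in>X. (\<exists>i. F i (rep_proj Q) \<noteq> 0) \<longrightarrow>
           compose X g f Q = abs_proj (\<chi> i. F i (rep_proj Q)))"
  proof (intro exI[of _ "d + e * d"] exI[of _ H] conjI allI ballI impI)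
    show "form (d + e * d) (H i)" for i
      unfolding H_def by (intro form.mult form_compose F G)
    show "\<exists>i. H i (rep_proj P) \<noteq> 0"
      using GF[OF P F(2)] G(2) i0 by (auto simp: H_def)
    fix Q assume Q: "Q \<in> X" and "\<exists>i. H i (rep_proj Q) \<noteq> 0"
    then obtain i where i: "F i0 (rep_proj Q) \<noteq> 0" "G i (\<chi> j. F j (rep_proj Q)) \<noteq> 0"
      by (auto simp: H_def)
    obtain c where c: "c \<noteq> 0" "\<And>i. G i (rep_proj (f Q)) = c * G i (\<chi> j. F j (rep_proj Q))"
      using GF[OF Q] i(1) by blast
    have "g (f Q) = abs_proj (\<chi> i. G i (rep_proj (f Q)))"
      by (rule Gg[OF fX[OF Q]]) (use c i in auto)
    also have "\<dots> = abs_proj (\<chi> i. H i (rep_proj Q))"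
      using c i by (subst abs_proj_eq_iff)
        (auto simp: vec_eq_iff H_def intro!: exI[of _ "F i0 (rep_proj Q) / c"])
    finally show "compose X g f Q = abs_proj (\<chi> i. H i (rep_proj Q))"
      using Q by (simp add: compose_def)
  qed
qed

section \<open>Self-morphisms of the projective line\<close>

lemma vector_2_nonzero_iff: "(vector [x, y] :: 'k::field ^ 2) \<noteq> 0 \<longleftrightarrow> x \<noteq> 0 \<or> y \<noteq> 0"
  by (auto simp: vec_eq_iff forall_2)

lemma abs_proj_2_eq_iff:
  fixes u v :: "'k::field"
  assumes "u \<noteq> 0 \<or> v \<noteq> 0" "u' \<noteq> 0 \<or> v' \<noteq> 0"
  shows "abs_proj (vector [u, v] :: 'k ^ 2) = abs_proj (vector [u', v']) \<longleftrightarrow> u * v' = v * u'"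
proof -
  have "(\<exists>c. c \<noteq> 0 \<and> u' = c * u \<and> v' = c * v) \<longleftrightarrow> u * v' = v * u'" (is "?L \<longleftrightarrow> ?R")
  proof
    assume ?R
    show ?L
    proof (cases "u = 0")
      case True
      with \<open>?R\<close> assms show ?thesis by (intro exI[of _ "v' / v"]) auto
    next
      case False
      with \<open>?R\<close> assms show ?thesis by (intro exI[of _ "u' / u"]) (auto simp: field_simps)
    qed
  qed auto
  then show ?thesis
    using assms by (subst abs_proj_eq_iff) (auto simp: vector_2_nonzero_iff vec_eq_iff forall_2)
qed

lemma proj_line_cases:
  fixes T :: "('k::field, 2) proj"
  obtains "T = abs_proj (vector [1, 0])" | x where "T = abs_proj (vector [x, 1])"
proof -
  define u v where uv: "u = rep_proj T $ 1" "v = rep_proj T $ 2"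
  have rep: "rep_proj T = vector [u, v]" by (simp add: uv vec_eq_iff forall_2)
  then have T: "T = abs_proj (vector [u, v])" using abs_rep_proj[of T] by simp
  have "u \<noteq> 0 \<or> v \<noteq> 0"
    using rep_proj_nonzero[of T] unfolding rep vector_2_nonzero_iff .
  then have "v = 0 \<Longrightarrow> T = abs_proj (vector [1, 0])"
    and "v \<noteq> 0 \<Longrightarrow> T = abs_proj (vector [u / v, 1])"
    unfolding T by (subst abs_proj_2_eq_iff; force)+
  then show thesis using that by blast
qed

text \<open>A binary form of degree \<open>d\<close> is the homogenisation of a polynomial of degree at most \<open>d\<close>,
  and its value at infinity is the coefficient of degree \<open>d\<close>.\<close>

lemma binary_form_poly:
  fixes F :: "'k::field ^ 2 \<Rightarrow> 'k"
  assumes "form d F"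
  obtains p where "degree p \<le> d" "\<And>x. F (vector [x, 1]) = poly p x" "F (vector [1, 0]) = coeff p d"
proof -
  from assms
  have "\<exists>p. degree p \<le> d \<and> (\<forall>x. F (vector [x, 1]) = poly p x) \<and> F (vector [1, 0]) = coeff p d"
  proof (induction rule: form.induct)
    case (const c)
    show ?case by (intro exI[of _ "[:c:]"]) simp
  next
    case (coord i)
    show ?case
      using exhaust_2[of i]
      by (auto intro: exI[of _ "[:0, 1:]"] exI[of _ 1])
  next
    case (add d F G)
    then obtain p q where "degree p \<le> d \<and> (\<forall>x. F (vector [x, 1]) = poly p x) \<and> F (vector [1, 0]) = coeff p d"
      "degree q \<le> d \<and> (\<forall>x. G (vector [x, 1]) = poly q x) \<and> G (vector [1, 0]) = coeff q d" by blast
    then show ?case by (intro exI[of _ "p + q"]) (simp add: degree_add_le)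
  next
    case (mult d F e G)
    then obtain p q where pq: "degree p \<le> d \<and> (\<forall>x. F (vector [x, 1]) = poly p x) \<and> F (vector [1, 0]) = coeff p d"
      "degree q \<le> e \<and> (\<forall>x. G (vector [x, 1]) = poly q x) \<and> G (vector [1, 0]) = coeff q e" by blast
    have "coeff (p * q) (d + e) = (\<Sum>i\<le>d + e. if i = d then coeff p d * coeff q e else 0)"
      unfolding coeff_mult
    proof (intro sum.cong refl)
      fix i assume "i \<in> {..d + e}"
      then show "coeff p i * coeff q (d + e - i) = (if i = d then coeff p d * coeff q e else 0)"
        using pq by (cases i d rule: linorder_cases) (auto simp: coeff_eq_0)
    qed
    then have "coeff (p * q) (d + e) = coeff p d * coeff q e" by simp
    moreover have "degree (p * q) \<le> d + e"
      using degree_mult_le[of p q] pq by linarith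
    ultimately show ?case using pq by (intro exI[of _ "p * q"]) simp
  qed
  then show thesis using that by blast
qed

text \<open>Near a point \<open>T\<close> a self-morphism of the line is a quotient of two polynomials \<open>p\<close>, \<open>q\<close> of
  degree at most \<open>d\<close>; at infinity the pair of coefficients of degree \<open>d\<close> takes the place of the
  pair of values.\<close>

lemma morphism_proj_line_local:
  fixes \<phi> :: "('k::field, 2) proj \<Rightarrow> ('k, 2) proj" and T :: "('k, 2) proj"
  assumes "morphism UNIV UNIV \<phi>"
  obtains d p q where "degree p \<le> d" "degree q \<le> d"
    "\<And>x. T = abs_proj (vector [x, 1]) \<Longrightarrow> poly p x \<noteq> 0 \<or> poly q x \<noteq> 0"
    "T = abs_proj (vector [1, 0]) \<Longrightarrow> coeff p d \<noteq> 0 \<or> coeff q d \<noteq> 0"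
    "\<And>x. poly p x \<noteq> 0 \<or> poly q x \<noteq> 0 \<Longrightarrow>
      \<phi> (abs_proj (vector [x, 1])) = abs_proj (vector [poly p x, poly q x])"
    "coeff p d \<noteq> 0 \<or> coeff q d \<noteq> 0 \<Longrightarrow>
      \<phi> (abs_proj (vector [1, 0])) = abs_proj (vector [coeff p d, coeff q d])"
proof -
  obtain d and F :: "2 \<Rightarrow> 'k ^ 2 \<Rightarrow> 'k" where F: "\<And>i. form d (F i)" and T: "\<exists>i. F i (rep_proj T) \<noteq> 0"
    and \<phi>: "\<And>Q. \<exists>i. F i (rep_proj Q) \<noteq> 0 \<Longrightarrow> \<phi> Q = abs_proj (\<chi> i. F i (rep_proj Q))"
    using assms unfolding morphism_def by blast
  obtain p where p: "degree p \<le> d" "\<And>x. F 1 (vector [x, 1]) = poly p x" "F 1 (vector [1, 0]) = coeff p d"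
    using binary_form_poly[OF F] by metis
  obtain q where q: "degree q \<le> d" "\<And>x. F 2 (vector [x, 1]) = poly q x" "F 2 (vector [1, 0]) = coeff q d"
    using binary_form_poly[OF F] by metis
  have at: "((\<exists>i. F i (rep_proj (abs_proj w)) \<noteq> 0) \<longleftrightarrow> F 1 w \<noteq> 0 \<or> F 2 w \<noteq> 0) \<and>
      (F 1 w \<noteq> 0 \<or> F 2 w \<noteq> 0 \<longrightarrow> \<phi> (abs_proj w) = abs_proj (vector [F 1 w, F 2 w]))"
    if w: "w \<noteq> 0" for w
  proof -
    obtain c where c: "c \<noteq> 0" "rep_proj (abs_proj w) = c *s w"
      using w by (rule rep_abs_proj)
    have Fc: "F i (rep_proj (abs_proj w)) = c ^ d * F i w" for i
      using c form_scale[OF F] by simp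
    have iff: "(\<exists>i. F i (rep_proj (abs_proj w)) \<noteq> 0) \<longleftrightarrow> F 1 w \<noteq> 0 \<or> F 2 w \<noteq> 0"
      using c(1) forall_2[of "\<lambda>i. F i w = 0"] unfolding Fc by auto
    moreover have "\<phi> (abs_proj w) = abs_proj (vector [F 1 w, F 2 w])" if "F 1 w \<noteq> 0 \<or> F 2 w \<noteq> 0"
    proof -
      have "(\<chi> i. F i (rep_proj (abs_proj w))) = vector [c ^ d * F 1 w, c ^ d * F 2 w]"
        by (simp add: vec_eq_iff forall_2 Fc)
      then have "\<phi> (abs_proj w) = abs_proj (vector [c ^ d * F 1 w, c ^ d * F 2 w])"
        using \<phi>[of "abs_proj w"] iff that by simp
      also have "\<dots> = abs_proj (vector [F 1 w, F 2 w])"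
        using that c(1) by (subst abs_proj_2_eq_iff) auto
      finally show ?thesis .
    qed
    ultimately show ?thesis by blast
  qed
  have nz: "(vector [x, 1] :: 'k ^ 2) \<noteq> 0" "(vector [1, 0] :: 'k ^ 2) \<noteq> 0" for x
    by (auto simp: vector_2_nonzero_iff)
  show thesis
    by (rule that[of p d q]) (use p q T at[OF nz(1)] at[OF nz(2)] in auto)
qed

text \<open>A pair of minimal degree among the nonzero ones proportional to \<open>(f, g)\<close> has no common root, since a
  common linear factor could be cancelled.\<close>

lemma coprime_representatives:
  fixes f g :: "'k::field poly"
  assumes "f \<noteq> 0 \<or> g \<noteq> 0"
  obtains h1 h2 where "f * h2 = g * h1" "\<And>x. poly h1 x \<noteq> 0 \<or> poly h2 x \<noteq> 0"
proof -
  define S where "S = (\<lambda>(h1, h2). (h1 \<noteq> 0 \<or> h2 \<noteq> 0) \<and> f * h2 = g * h1)"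
  have "S (f, g)" using assms by (simp add: S_def)
  then obtain h1 h2 where S: "S (h1, h2)"
    and min: "\<And>k1 k2. S (k1, k2) \<Longrightarrow> degree h1 + degree h2 \<le> degree k1 + degree k2"
    using arg_min_nat_lemma[of S "(f, g)" "\<lambda>(h1, h2). degree h1 + degree h2"]
    by (metis (mono_tags, lifting) case_prod_conv surj_pair)
  have "poly h1 x \<noteq> 0 \<or> poly h2 x \<noteq> 0" for x
  proof (rule ccontr)
    assume "\<not> ?thesis"
    then obtain k1 k2 where k: "h1 = [:-x, 1:] * k1" "h2 = [:-x, 1:] * k2"
      by (auto simp: poly_eq_0_iff_dvd elim!: dvdE)
    have "[:-x, 1:] * (f * k2) = [:-x, 1:] * (g * k1)"
      using S unfolding k S_def by (simp add: algebra_simps)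
    then have "f * k2 = g * k1" by (simp only: mult_cancel_left) auto
    then have "S (k1, k2)" using S unfolding k S_def by auto
    from min[OF this] have "degree h1 + degree h2 \<le> degree k1 + degree k2" .
    moreover have "degree ([:-x, 1:] * k) = (if k = 0 then 0 else Suc (degree k))" for k
      by (auto simp: degree_mult_eq simp del: mult_pCons_left)
    ultimately show False using S unfolding k S_def by (auto split: if_splits)
  qed
  then show thesis using that S by (auto simp: S_def)
qed

theorem morphism_proj_line_surj_or_const:
  fixes \<phi> :: "('k::{alg_closed_field, field_char_0}, 2) proj \<Rightarrow> ('k, 2) proj"
  assumes \<phi>: "morphism UNIV UNIV \<phi>"
  shows "surj \<phi> \<or> (\<exists>c. \<forall>T. \<phi> T = c)"
proof (cases "surj \<phi>")
  case False
  then obtain C where C: "C \<notin> range \<phi>" by auto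
  define \<alpha> \<beta> where ab: "\<alpha> = rep_proj C $ 1" "\<beta> = rep_proj C $ 2"
  have rep: "rep_proj C = vector [\<alpha>, \<beta>]" by (simp add: ab vec_eq_iff forall_2)
  then have C_eq: "C = abs_proj (vector [\<alpha>, \<beta>])" using abs_rep_proj[of C] by simp
  have ab_nz: "\<alpha> \<noteq> 0 \<or> \<beta> \<noteq> 0"
    using rep_proj_nonzero[of C] unfolding rep vector_2_nonzero_iff .
  have missed: "\<beta> * u - \<alpha> * v \<noteq> 0"
    if "u \<noteq> 0 \<or> v \<noteq> 0" "\<phi> T = abs_proj (vector [u, v])" for u v T
  proof
    assume "\<beta> * u - \<alpha> * v = 0"
    then have "\<phi> T = C"
      unfolding C_eq that(2) using that(1) ab_nz by (subst abs_proj_2_eq_iff) (auto simp: mult.commute)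
    then show False using C by blast
  qed
  obtain f g where fg0: "poly f 0 \<noteq> 0 \<or> poly g 0 \<noteq> 0"
    and fg: "\<And>x. poly f x \<noteq> 0 \<or> poly g x \<noteq> 0 \<Longrightarrow>
      \<phi> (abs_proj (vector [x, 1])) = abs_proj (vector [poly f x, poly g x])"
    by (rule morphism_proj_line_local[OF \<phi>, of "abs_proj (vector [0, 1])"]) blast
  have fg_nz: "f \<noteq> 0 \<or> g \<noteq> 0" using fg0 by auto
  obtain h1 h2 where h: "f * h2 = g * h1" and h_nz: "\<And>x. poly h1 x \<noteq> 0 \<or> poly h2 x \<noteq> 0"
    using coprime_representatives[OF fg_nz] by blast
  \<comment> \<open>Two local representations agree on a cofinite set, hence are proportional as polynomials.\<close>
  have proportional: "p * h2 = q * h1"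
    if pq: "p \<noteq> 0 \<or> q \<noteq> 0" and rep: "\<And>x. poly p x \<noteq> 0 \<or> poly q x \<noteq> 0 \<Longrightarrow>
      \<phi> (abs_proj (vector [x, 1])) = abs_proj (vector [poly p x, poly q x])" for p q
  proof -
    have vanish: "poly (p * g - q * f) x = 0" for x
    proof (cases "(poly p x \<noteq> 0 \<or> poly q x \<noteq> 0) \<and> (poly f x \<noteq> 0 \<or> poly g x \<noteq> 0)")
      case True
      then have "abs_proj (vector [poly p x, poly q x] :: 'k ^ 2) = abs_proj (vector [poly f x, poly g x])"
        using rep fg by metis
      then show ?thesis using True by (simp add: abs_proj_2_eq_iff)
    qed auto
    have pg: "p * g = q * f"
      using vanish poly_eq_poly_eq_iff[of "p * g - q * f" 0] by (simp add: fun_eq_iff)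
    show ?thesis
    proof (cases "f = 0")
      case True
      then show ?thesis using h fg_nz pg by auto
    next
      case False
      have "f * (p * h2) = p * (f * h2)" by (rule mult.left_commute)
      also have "\<dots> = p * g * h1" by (simp only: h mult.assoc)
      also have "\<dots> = f * (q * h1)" unfolding pg by (simp only: mult_ac)
      finally show ?thesis using False by simp
    qed
  qed
  have on_affine: "\<phi> (abs_proj (vector [x, 1])) = abs_proj (vector [poly h1 x, poly h2 x])" for x
  proof -
    obtain p q where nz: "poly p x \<noteq> 0 \<or> poly q x \<noteq> 0"
      and rep: "\<And>x. poly p x \<noteq> 0 \<or> poly q x \<noteq> 0 \<Longrightarrow>
        \<phi> (abs_proj (vector [x, 1])) = abs_proj (vector [poly p x, poly q x])"
      by (rule morphism_proj_line_local[OF \<phi>, of "abs_proj (vector [x, 1])"]) blast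
    have "p * h2 = q * h1" using nz by (intro proportional rep) auto
    then have "poly p x * poly h2 x = poly q x * poly h1 x" by (metis poly_mult)
    then show ?thesis
      unfolding rep[OF nz] using nz h_nz[of x] by (subst abs_proj_2_eq_iff) auto
  qed
  \<comment> \<open>The linear form vanishing at the missed point \<open>C\<close>, evaluated at \<open>(h1, h2)\<close>, has no root.\<close>
  define r where "r = smult \<beta> h1 - smult \<alpha> h2"
  have "poly r x \<noteq> 0" for x
    using missed[OF h_nz on_affine] by (simp add: r_def)
  then have "degree r = 0"
    using alg_closed_imp_poly_has_root[of r] by auto
  then obtain r0 where r0: "r = [:r0:]" by (rule degree_eq_zeroE)
  have r0_nz: "r0 \<noteq> 0" using \<open>\<And>x. poly r x \<noteq> 0\<close>[of 0] r0 by simp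
  obtain d p q where deg: "degree p \<le> d" "degree q \<le> d"
    and nz: "coeff p d \<noteq> 0 \<or> coeff q d \<noteq> 0"
    and rep: "\<And>x. poly p x \<noteq> 0 \<or> poly q x \<noteq> 0 \<Longrightarrow>
        \<phi> (abs_proj (vector [x, 1])) = abs_proj (vector [poly p x, poly q x])"
    and inf: "\<phi> (abs_proj (vector [1, 0])) = abs_proj (vector [coeff p d, coeff q d])"
    by (rule morphism_proj_line_local[OF \<phi>, of "abs_proj (vector [1, 0])"]) blast
  have pq: "p * h2 = q * h1" using nz by (intro proportional rep) auto
  \<comment> \<open>The same linear form at the representation \<open>(p, q)\<close>, which is valid at infinity.\<close>
  define s where "s = smult \<beta> p - smult \<alpha> q"
  have s_d: "coeff s d \<noteq> 0" using missed[OF nz inf] by (simp add: s_def)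
  have sh1: "s * h1 = smult r0 p"
  proof -
    have "s * h1 = smult \<beta> (p * h1) - smult \<alpha> (q * h1)" by (simp add: s_def algebra_simps)
    also have "\<dots> = p * r" unfolding pq[symmetric] by (simp add: r_def algebra_simps)
    finally show ?thesis using r0 by simp
  qed
  have sh2: "s * h2 = smult r0 q"
  proof -
    have "s * h2 = smult \<beta> (p * h2) - smult \<alpha> (q * h2)" by (simp add: s_def algebra_simps)
    also have "\<dots> = q * r" unfolding pq by (simp add: r_def algebra_simps)
    finally show ?thesis using r0 by simp
  qed
  \<comment> \<open>As \<open>s\<close> already has the full degree \<open>d\<close>, there is no room for a nonconstant cofactor.\<close>
  have deg0: "degree h = 0" if "s * h = smult r0 t" "degree t \<le> d" for h t
  proof (cases "h = 0")
    case False
    have "d + degree h \<le> degree (s * h)"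
      using s_d le_degree[OF s_d] False by (subst degree_mult_eq) auto
    also have "\<dots> \<le> d" using that r0_nz by simp
    finally show ?thesis by simp
  qed simp
  obtain c1 c2 where c: "h1 = [:c1:]" "h2 = [:c2:]"
    using deg0[OF sh1 deg(1)] deg0[OF sh2 deg(2)] by (metis degree_eq_zeroE)
  have "\<phi> (abs_proj (vector [1, 0])) = abs_proj (vector [c1, c2])"
  proof -
    have "coeff p d * c2 = coeff q d * c1"
      using pq unfolding c by (metis coeff_smult mult.commute mult_pCons_right mult_zero_right pCons_0_0 add.right_neutral)
    then show ?thesis
      unfolding inf using nz h_nz[of 0] c by (subst abs_proj_2_eq_iff) auto
  qed
  then have "\<phi> T = abs_proj (vector [c1, c2])" for T
    using on_affine c by (cases T rule: proj_line_cases) auto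
  then show ?thesis by blast
qed simp

section \<open>The chord-tangent law\<close>

lemma ec_add_origin [simp]: "ec_add a origin Q = Q" "ec_add a P origin = P"
  by (simp_all add: ec_add_def)

text \<open>The line \<open>y = m (x - x1) + y1\<close> through a point of the curve meets it again over \<open>x2\<close> and \<open>x3\<close>.
  The second hypothesis says that \<open>m\<close> is the slope of the chord or tangent, in a form without
  denominators that covers both cases.\<close>

lemma third_intersection_in_curve:
  fixes a b m x1 x2 y1 :: "'k::field"
  assumes y1: "y1\<^sup>2 = x1 ^ 3 + a * x1 + b"
    and m: "m * (2 * y1 + m * (x2 - x1)) = x1\<^sup>2 + x1 * x2 + x2\<^sup>2 + a"
    and x3: "x3 = m\<^sup>2 - x1 - x2"
  shows "affine_pt x3 (m * (x1 - x3) - y1) \<in> curve a b"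
proof -
  have "(m * (x1 - x3) - y1)\<^sup>2 - (x3 ^ 3 + a * x3 + b) =
      (y1\<^sup>2 - (x1 ^ 3 + a * x1 + b))
      + (x3 - x1) * (m * (2 * y1 + m * (x2 - x1)) - (x1\<^sup>2 + x1 * x2 + x2\<^sup>2 + a))"
    unfolding x3 by (simp add: power2_eq_square power3_eq_cube algebra_simps)
  then show ?thesis unfolding affine_pt_in_curve using y1 m by simp
qed

lemma ec_add_closed:
  fixes a b :: "'k::field_char_0"
  assumes "P \<in> curve a b" "Q \<in> curve a b"
  shows "ec_add a P Q \<in> curve a b"
  using assms(1)
proof (cases rule: curve_cases)
  case 1
  then show ?thesis using assms by simp
next
  case P: (2 x1 y1)
  from assms(2) show ?thesis
  proof (cases rule: curve_cases)
    case 1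
    then show ?thesis using assms by simp
  next
    case Q: (2 x2 y2)
    show ?thesis
    proof (cases "x1 = x2 \<and> y1 = - y2")
      case True
      then show ?thesis by (simp add: P Q ec_add_def origin_in_curve)
    next
      case False
      define m where "m = (if x1 = x2 then (3 * x1\<^sup>2 + a) / (2 * y1) else (y2 - y1) / (x2 - x1))"
      define x3 where "x3 = m\<^sup>2 - x1 - x2"
      have "m * (2 * y1 + m * (x2 - x1)) = x1\<^sup>2 + x1 * x2 + x2\<^sup>2 + a"
      proof (cases "x1 = x2")
        case True
        then have "y1\<^sup>2 = y2\<^sup>2" using P Q by simp
        then have "y1 = y2" "y1 \<noteq> 0" using False True by (auto simp: power2_eq_iff)
        then show ?thesis using True by (simp add: m_def power2_eq_square)
      next
        case ne: False
        have m: "m * (x2 - x1) = y2 - y1" using ne by (simp add: m_def)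
        have "(x2 - x1) * (m * (y1 + y2)) = (y2 - y1) * (y1 + y2)"
          unfolding m[symmetric] by (simp add: algebra_simps)
        also have "\<dots> = y2\<^sup>2 - y1\<^sup>2" by (simp add: power2_eq_square power3_eq_cube algebra_simps)
        also have "\<dots> = (x2 - x1) * (x1\<^sup>2 + x1 * x2 + x2\<^sup>2 + a)"
          unfolding P Q by (simp add: power2_eq_square power3_eq_cube algebra_simps)
        finally have "m * (y1 + y2) = x1\<^sup>2 + x1 * x2 + x2\<^sup>2 + a" using ne by simp
        then show ?thesis unfolding m by (simp add: algebra_simps)
      qed
      then have "affine_pt x3 (m * (x1 - x3) - y1) \<in> curve a b"
        by (rule third_intersection_in_curve[OF P(2) _ x3_def])
      moreover have "ec_add a P Q = affine_pt x3 (m * (x1 - x3) - y1)"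
        using False unfolding P(1) Q(1) ec_add_def x3_def m_def by (simp add: Let_def)
      ultimately show ?thesis by simp
    qed
  qed
qed

lemma ec_neg_in_curve: "P \<in> curve a b \<Longrightarrow> ec_neg P \<in> curve a b"
  by (erule curve_cases) (simp_all add: origin_in_curve affine_pt_in_curve)

lemma ec_neg_neg: "P \<in> curve a b \<Longrightarrow> ec_neg (ec_neg P) = P"
  by (erule curve_cases) simp_all

lemma ec_neg_ec_add:
  assumes "P \<in> curve a b" "Q \<in> curve a b"
  shows "ec_neg (ec_add a P Q) = ec_add a (ec_neg P) (ec_neg Q)"
  using assms(1)
proof (cases rule: curve_cases)
  case P: (2 x1 y1)
  from assms(2) show ?thesis
  proof (cases rule: curve_cases)
    case Q: (2 x2 y2)
    have "(y1 - y2) / (x2 - x1) = - ((y2 - y1) / (x2 - x1))"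
      by (metis minus_diff_eq minus_divide_left)
    then show ?thesis unfolding P(1) Q(1)
      by (auto simp: ec_add_def Let_def algebra_simps)
  qed simp
qed simp

lemma ec_add_eq_origin:
  assumes "P \<in> curve a b" "Q \<in> curve a b" "ec_add a P Q = origin"
  shows "Q = ec_neg P"
  using assms(1)
proof (cases rule: curve_cases)
  case P: (2 x1 y1)
  from assms(2) show ?thesis
    by (cases rule: curve_cases) (use assms(3) P in \<open>auto simp: ec_add_def Let_def split: if_splits\<close>)
qed (use assms in simp)

lemma ec_double_eq_self:
  fixes a b :: "'k::field_char_0"
  assumes "P \<in> curve a b" "ec_add a P P = P"
  shows "P = origin"
  using assms(1)
proof (cases rule: curve_cases)
  case P: (2 x y)
  show ?thesis
  proof (cases "y = - y")
    case True
    then show ?thesis using assms(2) by (simp add: P ec_add_def)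
  next
    case False
    then have "\<exists>m. m\<^sup>2 - x - x = x \<and> m * (x - (m\<^sup>2 - x - x)) - y = y"
      using assms(2) by (auto simp: P ec_add_def Let_def)
    then obtain m where "m\<^sup>2 - x - x = x" "m * (x - (m\<^sup>2 - x - x)) - y = y" by blast
    then have "- y = y" by simp
    with False show ?thesis by simp
  qed
qed

text \<open>A point over any \<open>x\<close> outside the finite set of roots of \<open>x\<^sup>3 + a x + b\<close> has \<open>y \<noteq> 0\<close>.\<close>

lemma exists_not_2_torsion:
  fixes a b :: "'k::{alg_closed_field, field_char_0}"
  obtains T where "T \<in> curve a b" "ec_neg T \<noteq> T"
proof -
  have "[:b, a, 0, 1:] \<noteq> 0" by simp
  then have "finite {x. poly [:b, a, 0, 1:] x = 0}" by (rule poly_roots_finite)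
  then obtain x where x: "poly [:b, a, 0, 1:] x \<noteq> 0"
    using ex_new_if_finite[OF infinite_UNIV_char_0] by blast
  obtain y where y: "y\<^sup>2 = x ^ 3 + a * x + b"
    using nth_root_exists[of 2 "x ^ 3 + a * x + b"] by auto
  have "y \<noteq> 0" using x y by (auto simp: power3_eq_cube algebra_simps)
  then show thesis
    using that[of "affine_pt x y"] y by (simp add: affine_pt_in_curve neg_eq_iff_add_eq_0)
qed

section \<open>Endomorphisms\<close>

lemma End_ring_iff:
  "f \<in> carrier (End_ring a b) \<longleftrightarrow>
     f \<in> extensional (curve a b) \<and> morphism (curve a b) (curve a b) f \<and>
     f \<in> curve a b \<rightarrow> curve a b \<and>
     (\<forall>P\<in>curve a b. \<forall>Q\<in>curve a b. f (ec_add a P Q) = ec_add a (f P) (f Q))"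
  by (auto simp: End_ring_def hom_def curve_group_def)

lemma End_ring_sel:
  "f \<otimes>\<^bsub>End_ring a b\<^esub> g = compose (curve a b) f g"
  "\<one>\<^bsub>End_ring a b\<^esub> = (\<lambda>P\<in>curve a b. P)"
  "\<zero>\<^bsub>End_ring a b\<^esub> = (\<lambda>P\<in>curve a b. origin)"
  "f \<oplus>\<^bsub>End_ring a b\<^esub> g = (\<lambda>P\<in>curve a b. ec_add a (f P) (g P))"
  by (simp_all add: End_ring_def)

lemma End_closed: "f \<in> carrier (End_ring a b) \<Longrightarrow> P \<in> curve a b \<Longrightarrow> f P \<in> curve a b"
  by (auto simp: End_ring_iff)

lemma End_origin:
  fixes a b :: "'k::field_char_0"
  assumes "f \<in> carrier (End_ring a b)"
  shows "f origin = origin"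
proof -
  have "ec_add a (f origin) (f origin) = f origin"
    using assms origin_in_curve[of a b] by (metis End_ring_iff ec_add_origin(1))
  then show ?thesis
    using ec_double_eq_self[OF End_closed[OF assms origin_in_curve]] by simp
qed

lemma End_neg:
  fixes a b :: "'k::field_char_0"
  assumes f: "f \<in> carrier (End_ring a b)" and P: "P \<in> curve a b"
  shows "f (ec_neg P) = ec_neg (f P)"
proof -
  have "ec_add a (f P) (f (ec_neg P)) = f (ec_add a P (ec_neg P))"
    using f P ec_neg_in_curve[OF P] by (simp add: End_ring_iff)
  also have "\<dots> = origin" by (simp add: ec_add_ec_neg[OF P] End_origin[OF f])
  finally show ?thesis
    by (rule ec_add_eq_origin[OF End_closed[OF f P] End_closed[OF f ec_neg_in_curve[OF P]]])
qed

lemma End_mult_closed: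
  fixes a b :: "'k::field_char_0"
  assumes "f \<in> carrier (End_ring a b)" "g \<in> carrier (End_ring a b)"
  shows "f \<otimes>\<^bsub>End_ring a b\<^esub> g \<in> carrier (End_ring a b)"
  using assms morphism_compose[of "curve a b" "curve a b" g "curve a b" f]
  by (auto simp: End_ring_iff End_ring_sel compose_eq ec_add_closed Pi_iff)

lemma morphism_id: "morphism X X (\<lambda>P\<in>X. P)"
  unfolding morphism_def
proof (intro conjI ballI)
  fix P assume "P \<in> X"
  have "\<exists>i. rep_proj P $ i \<noteq> 0" using rep_proj_nonzero[of P] by (auto simp: vec_eq_iff)
  then show "\<exists>d F. (\<forall>i. form d (F i)) \<and> (\<exists>i. F i (rep_proj P) \<noteq> 0) \<and>
      (\<forall>Q\<in>X. (\<exists>i. F i (rep_proj Q) \<noteq> 0) \<longrightarrow> (\<lambda>P\<in>X. P) Q = abs_proj (\<chi> i. F i (rep_proj Q)))"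
    by (intro exI[of _ 1] exI[of _ "\<lambda>i v. v $ i"]) (use form.coord in auto)
qed auto

lemma morphism_const:
  assumes "C \<in> Y"
  shows "morphism X Y (\<lambda>P\<in>X. C)"
  unfolding morphism_def
proof (intro conjI ballI)
  fix P assume "P \<in> X"
  have "\<exists>i. rep_proj C $ i \<noteq> 0" using rep_proj_nonzero[of C] by (auto simp: vec_eq_iff)
  then show "\<exists>d F. (\<forall>i. form d (F i)) \<and> (\<exists>i. F i (rep_proj P) \<noteq> 0) \<and>
      (\<forall>Q\<in>X. (\<exists>i. F i (rep_proj Q) \<noteq> 0) \<longrightarrow> (\<lambda>P\<in>X. C) Q = abs_proj (\<chi> i. F i (rep_proj Q)))"
    by (intro exI[of _ 0] exI[of _ "\<lambda>i v. rep_proj C $ i"]) (auto intro: form.const)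
qed (use assms in auto)

lemma morphism_ec_neg: "morphism (curve a b) (curve a b) (\<lambda>P\<in>curve a b. ec_neg P)"
  unfolding morphism_def
proof (intro conjI ballI)
  define F :: "3 \<Rightarrow> 'a ^ 3 \<Rightarrow> 'a" where "F i v = (if i = 2 then - 1 else 1) * v $ i" for i v
  fix P :: "('a, 3) proj" assume "P \<in> curve a b"
  have "F i v \<noteq> 0 \<longleftrightarrow> v $ i \<noteq> 0" for i v by (simp add: F_def)
  then have "\<exists>i. F i (rep_proj P) \<noteq> 0" using rep_proj_nonzero[of P] by (simp add: vec_eq_iff)
  moreover have "form (0 + 1) (F i)" for i
    unfolding F_def by (intro form.mult form.const form.coord)
  moreover have "ec_neg Q = abs_proj (\<chi> i. F i (rep_proj Q))" for Q
    unfolding ec_neg_def by (intro arg_cong[of _ _ abs_proj]) (simp add: vec_eq_iff forall_3 F_def)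
  ultimately show "\<exists>d F. (\<forall>i. form d (F i)) \<and> (\<exists>i. F i (rep_proj P) \<noteq> 0) \<and>
      (\<forall>Q\<in>curve a b. (\<exists>i. F i (rep_proj Q) \<noteq> 0) \<longrightarrow>
        (\<lambda>P\<in>curve a b. ec_neg P) Q = abs_proj (\<chi> i. F i (rep_proj Q)))"
    by (intro exI[of _ "0 + 1"] exI[of _ F]) simp
qed (use ec_neg_in_curve in auto)

lemma End_one_closed:
  fixes a b :: "'k::field_char_0"
  shows "\<one>\<^bsub>End_ring a b\<^esub> \<in> carrier (End_ring a b)"
  by (auto simp: End_ring_iff End_ring_sel morphism_id ec_add_closed)

lemma End_zero_closed:
  fixes a b :: "'k::field_char_0"
  shows "\<zero>\<^bsub>End_ring a b\<^esub> \<in> carrier (End_ring a b)"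
  by (auto simp: End_ring_iff End_ring_sel morphism_const ec_add_closed origin_in_curve)

lemma End_minus_one_closed:
  fixes a b :: "'k::field_char_0"
  shows "(\<lambda>P\<in>curve a b. ec_neg P) \<in> carrier (End_ring a b)"
  by (auto simp: End_ring_iff morphism_ec_neg ec_add_closed ec_neg_in_curve ec_neg_ec_add)

lemma End_pow_closed:
  fixes a b :: "'k::field_char_0" and m :: nat
  assumes "f \<in> carrier (End_ring a b)"
  shows "f [^]\<^bsub>End_ring a b\<^esub> m \<in> carrier (End_ring a b)"
  by (induction m) (simp_all add: End_one_closed End_mult_closed assms)

lemma End_pow_apply:
  fixes m :: nat
  assumes "f \<in> carrier (End_ring a b)" "P \<in> curve a b"
  shows "(f [^]\<^bsub>End_ring a b\<^esub> m) P = (f ^^ m) P"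
  using assms(2)
proof (induction m arbitrary: P)
  case (Suc m)
  then show ?case
    using End_closed[OF assms(1)] by (simp add: End_ring_sel compose_eq funpow_swap1)
qed (simp add: End_ring_sel)

text \<open>The induced map \<open>\<phi>\<close> of the line is surjective, so every \<open>Q\<close> is \<open>f P\<close> up to sign for some \<open>P\<close>,
  and the sign can be moved to \<open>P\<close>.\<close>

lemma End_surj:
  fixes a b :: "'k::{alg_closed_field, field_char_0}"
  assumes f: "f \<in> carrier (End_ring a b)" and nz: "f \<noteq> \<zero>\<^bsub>End_ring a b\<^esub>"
    and \<phi>: "induced_on_P1 a b f \<phi>"
  shows "f ` curve a b = curve a b"
proof -
  have ind: "\<phi> (pi_map P) = pi_map (f P)" if "P \<in> curve a b" for P
    using \<phi> that by (simp add: induced_on_P1_def)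
  have "\<not> (\<exists>c. \<forall>T. \<phi> T = c)"
  proof
    assume "\<exists>c. \<forall>T. \<phi> T = c"
    then have "pi_map (f P) = pi_map origin" if "P \<in> curve a b" for P
      using ind[OF that] ind[OF origin_in_curve] End_origin[OF f] by metis
    then have "f P = origin" if "P \<in> curve a b" for P
      using that pi_eq_iff[OF origin_in_curve End_closed[OF f that]] by simp
    then have "f = \<zero>\<^bsub>End_ring a b\<^esub>"
      using f by (intro extensionalityI[of _ "curve a b"]) (auto simp: End_ring_iff End_ring_sel)
    with nz show False by simp
  qed
  then have surj: "surj \<phi>"
    using morphism_proj_line_surj_or_const[of \<phi>] \<phi> unfolding induced_on_P1_def by blast
  have "Q \<in> f ` curve a b" if Q: "Q \<in> curve a b" for Q
  proof -
    obtain P where P: "P \<in> curve a b" "\<phi> (pi_map P) = pi_map Q"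
      using surj pi_surj[of a b] by (metis imageE surjD UNIV_I)
    then have "pi_map (f P) = pi_map Q" using ind by simp
    then have "Q = f P \<or> Q = f (ec_neg P)"
      using pi_eq_iff[OF End_closed[OF f P(1)] Q] End_neg[OF f P(1)] by simp
    then show ?thesis using P(1) ec_neg_in_curve by blast
  qed
  then show ?thesis using End_closed[OF f] by auto
qed

section \<open>Relations in the fraction field\<close>

lemma (in field) quotient_pow:
  fixes k :: nat
  assumes "x \<in> carrier R" "y \<in> carrier R" "y \<noteq> \<zero>"
  shows "(x \<otimes> inv y) [^] k \<otimes> y [^] k = x [^] k"
proof -
  have iy: "inv y \<in> carrier R" "inv y \<otimes> y = \<one>"
    using assms field_Units by auto
  have "(x \<otimes> inv y) [^] k \<otimes> y [^] k = (x \<otimes> inv y \<otimes> y) [^] k"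
    using assms iy by (simp add: nat_pow_distrib)
  then show ?thesis using assms iy by (simp add: m_assoc)
qed

context
  fixes a b :: "'k::{alg_closed_field, field_char_0}"
    and F :: "('f, 'v) ring_scheme" and \<iota> :: "(('k, 3) proj \<Rightarrow> ('k, 3) proj) \<Rightarrow> 'f"
  assumes frac: "is_fraction_field (End_ring a b) F \<iota>"
begin

interpretation F: field F
  using frac by (simp add: is_fraction_field_def)

text \<open>That \<open>End_ring a b\<close> satisfies the ring axioms is not needed: the properties of \<open>\<iota>\<close> below,
  together with closure of the endomorphisms under composition and negation, suffice.\<close>

lemma iota:
  shows iota_closed: "f \<in> carrier (End_ring a b) \<Longrightarrow> \<iota> f \<in> carrier F"
    and iota_mult: "\<lbrakk>f \<in> carrier (End_ring a b); g \<in> carrier (End_ring a b)\<rbrakk>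
      \<Longrightarrow> \<iota> (f \<otimes>\<^bsub>End_ring a b\<^esub> g) = \<iota> f \<otimes>\<^bsub>F\<^esub> \<iota> g"
    and iota_add: "\<lbrakk>f \<in> carrier (End_ring a b); g \<in> carrier (End_ring a b)\<rbrakk>
      \<Longrightarrow> \<iota> (f \<oplus>\<^bsub>End_ring a b\<^esub> g) = \<iota> f \<oplus>\<^bsub>F\<^esub> \<iota> g"
    and iota_one: "\<iota> \<one>\<^bsub>End_ring a b\<^esub> = \<one>\<^bsub>F\<^esub>"
    and iota_inj: "\<lbrakk>\<iota> f = \<iota> g; f \<in> carrier (End_ring a b); g \<in> carrier (End_ring a b)\<rbrakk> \<Longrightarrow> f = g"
  using frac by (auto simp: is_fraction_field_def ring_hom_def dest: inj_onD)

lemma iota_zero: "\<iota> \<zero>\<^bsub>End_ring a b\<^esub> = \<zero>\<^bsub>F\<^esub>"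
proof -
  have "\<zero>\<^bsub>End_ring a b\<^esub> \<oplus>\<^bsub>End_ring a b\<^esub> \<zero>\<^bsub>End_ring a b\<^esub> = \<zero>\<^bsub>End_ring a b\<^esub>"
    by (auto simp: End_ring_sel)
  then have "\<iota> \<zero>\<^bsub>End_ring a b\<^esub> \<oplus>\<^bsub>F\<^esub> \<iota> \<zero>\<^bsub>End_ring a b\<^esub> = \<iota> \<zero>\<^bsub>End_ring a b\<^esub>"
    using iota_add[OF End_zero_closed End_zero_closed] by simp
  then show ?thesis using iota_closed[OF End_zero_closed] by (metis F.add.l_cancel_one')
qed

lemma iota_minus:
  assumes f: "f \<in> carrier (End_ring a b)"
  shows "\<iota> (compose (curve a b) (\<lambda>P\<in>curve a b. ec_neg P) f) = \<ominus>\<^bsub>F\<^esub> \<iota> f"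
proof -
  let ?g = "compose (curve a b) (\<lambda>P\<in>curve a b. ec_neg P) f"
  have g: "?g \<in> carrier (End_ring a b)"
    using End_mult_closed[OF End_minus_one_closed f] by (simp add: End_ring_sel)
  have "f \<oplus>\<^bsub>End_ring a b\<^esub> ?g = \<zero>\<^bsub>End_ring a b\<^esub>"
    unfolding End_ring_sel
    by (rule restrict_ext) (simp add: End_closed[OF f] compose_eq ec_add_ec_neg[OF End_closed[OF f]])
  then have "\<iota> f \<oplus>\<^bsub>F\<^esub> \<iota> ?g = \<zero>\<^bsub>F\<^esub>"
    using iota_add[OF f g] iota_zero by simp
  then show ?thesis
    using iota_closed[OF f] iota_closed[OF g] by (metis F.add.inv_equality F.add.m_comm)
qed

lemma iota_pow:
  fixes m :: nat
  assumes "f \<in> carrier (End_ring a b)"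
  shows "\<iota> (f [^]\<^bsub>End_ring a b\<^esub> m) = \<iota> f [^]\<^bsub>F\<^esub> m"
  by (induction m) (simp_all add: iota_one iota_mult End_pow_closed assms)

text \<open>Commutativity is inherited from the field.\<close>

lemma End_commute:
  assumes f: "f \<in> carrier (End_ring a b)" and g: "g \<in> carrier (End_ring a b)"
    and P: "P \<in> curve a b"
  shows "f (g P) = g (f P)"
proof -
  have "f \<otimes>\<^bsub>End_ring a b\<^esub> g = g \<otimes>\<^bsub>End_ring a b\<^esub> f"
    by (rule iota_inj)
      (use f g in \<open>simp_all add: iota_mult iota_closed End_mult_closed F.m_comm\<close>)
  then show ?thesis using P by (metis End_ring_sel(1) compose_eq)
qed

lemma End_pow_quotient:
  fixes k :: nat
  assumes f: "f \<in> carrier (End_ring a b)" and g: "g \<in> carrier (End_ring a b)"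
    and nz: "g \<noteq> \<zero>\<^bsub>End_ring a b\<^esub>" and P: "P \<in> curve a b"
  shows "(\<iota> f \<otimes>\<^bsub>F\<^esub> inv\<^bsub>F\<^esub> \<iota> g) [^]\<^bsub>F\<^esub> k = \<one>\<^bsub>F\<^esub> \<Longrightarrow> (f ^^ k) P = (g ^^ k) P"
    and "(\<iota> f \<otimes>\<^bsub>F\<^esub> inv\<^bsub>F\<^esub> \<iota> g) [^]\<^bsub>F\<^esub> k = \<ominus>\<^bsub>F\<^esub> \<one>\<^bsub>F\<^esub> \<Longrightarrow> (f ^^ k) P = ec_neg ((g ^^ k) P)"
proof -
  let ?f = "f [^]\<^bsub>End_ring a b\<^esub> k" and ?g = "g [^]\<^bsub>End_ring a b\<^esub> k"
  let ?q = "(\<iota> f \<otimes>\<^bsub>F\<^esub> inv\<^bsub>F\<^esub> \<iota> g) [^]\<^bsub>F\<^esub> k"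
  have fk: "?f \<in> carrier (End_ring a b)" and gk: "?g \<in> carrier (End_ring a b)"
    using f g by (simp_all add: End_pow_closed)
  have "\<iota> g \<noteq> \<zero>\<^bsub>F\<^esub>"
    using iota_inj[OF _ g End_zero_closed] nz iota_zero by auto
  then have q: "\<iota> ?f = ?q \<otimes>\<^bsub>F\<^esub> \<iota> ?g"
    using F.quotient_pow[OF iota_closed[OF f] iota_closed[OF g]] f g by (simp add: iota_pow)
  show "(f ^^ k) P = (g ^^ k) P" if "?q = \<one>\<^bsub>F\<^esub>"
  proof -
    have "?f = ?g" using q that iota_closed[OF gk] by (intro iota_inj fk gk) simp
    then show ?thesis using End_pow_apply[OF f P] End_pow_apply[OF g P] by metis
  qed
  show "(f ^^ k) P = ec_neg ((g ^^ k) P)" if "?q = \<ominus>\<^bsub>F\<^esub> \<one>\<^bsub>F\<^esub>"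
  proof -
    have "?f = compose (curve a b) (\<lambda>P\<in>curve a b. ec_neg P) ?g"
    proof (rule iota_inj[OF _ fk])
      show "compose (curve a b) (\<lambda>P\<in>curve a b. ec_neg P) ?g \<in> carrier (End_ring a b)"
        using End_mult_closed[OF End_minus_one_closed gk] by (simp add: End_ring_sel)
      show "\<iota> ?f = \<iota> (compose (curve a b) (\<lambda>P\<in>curve a b. ec_neg P) ?g)"
        using q that iota_closed[OF gk] by (simp add: iota_minus gk F.l_minus)
    qed
    then have "?f P = ec_neg (?g P)" using P End_closed[OF gk P] by (simp add: compose_eq)
    then show ?thesis using End_pow_apply[OF f P] End_pow_apply[OF g P] by simp
  qed
qed

end

section \<open>Images of the diagonal\<close>

lemma funpow_image_eq: "f ` X = X \<Longrightarrow> (f ^^ m) ` X = X"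
proof (induction m)
  case (Suc m)
  have "(f ^^ Suc m) ` X = f ` (f ^^ m) ` X" by (simp add: image_image)
  then show ?case using Suc by simp
qed simp

lemma diagonal_image:
  fixes f g :: "'x \<Rightarrow> 'x"
  shows "(map_prod f g ^^ m) ` diagonal X = (\<lambda>P. ((f ^^ m) P, (g ^^ m) P)) ` X"
proof -
  have "map_prod f g ^^ m = map_prod (f ^^ m) (g ^^ m)"
    by (induction m) (auto simp: fun_eq_iff)
  then show ?thesis by (auto simp: diagonal_def)
qed

text \<open>If \<open>f\<^sup>k = s \<circ> g\<^sup>k\<close> on \<open>X\<close>, the substitution \<open>Q = g\<^sup>k P\<close>, which is onto \<open>X\<close>, removes the
  exponent \<open>k\<close> from the image of the diagonal.\<close>

lemma diagonal_image_shift: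
  fixes f g :: "'x \<Rightarrow> 'x"
  assumes fg: "\<And>P. P \<in> X \<Longrightarrow> (f ^^ k) P = s ((g ^^ k) P)" and g: "g ` X = X"
  shows "(map_prod f g ^^ (n + k)) ` diagonal X = (\<lambda>Q. ((f ^^ n) (s Q), (g ^^ n) Q)) ` X"
proof -
  have "(map_prod f g ^^ (n + k)) ` diagonal X =
      (\<lambda>P. ((f ^^ n) (s ((g ^^ k) P)), (g ^^ n) ((g ^^ k) P))) ` X"
    unfolding diagonal_image by (intro image_cong refl) (simp add: funpow_add fg)
  also have "\<dots> = (\<lambda>Q. ((f ^^ n) (s Q), (g ^^ n) Q)) ` (g ^^ k) ` X"
    by (simp add: image_image)
  finally show ?thesis unfolding funpow_image_eq[OF g] .
qed

lemma induced_diagonal_image: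
  fixes a b :: "'k::alg_closed_field"
  assumes f: "f \<in> carrier (End_ring a b)" "induced_on_P1 a b f \<phi>"
    and g: "g \<in> carrier (End_ring a b)" "induced_on_P1 a b g \<psi>"
  shows "(map_prod \<phi> \<psi> ^^ m) ` diagonal UNIV =
    map_prod pi_map pi_map ` (map_prod f g ^^ m) ` diagonal (curve a b)"
proof -
  have iter: "(\<theta> ^^ m) (pi_map P) = pi_map ((h ^^ m) P) \<and> (h ^^ m) P \<in> curve a b"
    if "h \<in> carrier (End_ring a b)" "induced_on_P1 a b h \<theta>" "P \<in> curve a b" for h \<theta> P
    using that by (induction m) (auto simp: induced_on_P1_def End_closed)
  show ?thesis
    unfolding diagonal_image pi_surj[of a b, symmetric] image_image
    using iter[OF f] iter[OF g] by (intro image_cong refl) simp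
qed

lemma End_pow_neg:
  fixes a b :: "'k::field_char_0"
  assumes "f \<in> carrier (End_ring a b)" "P \<in> curve a b"
  shows "(f ^^ m) (ec_neg P) = ec_neg ((f ^^ m) P)"
  using End_neg[OF End_pow_closed[OF assms(1), of m] assms(2)] assms
  by (simp add: End_pow_apply ec_neg_in_curve)

lemma End_pow_in_curve:
  "f \<in> carrier (End_ring a b) \<Longrightarrow> P \<in> curve a b \<Longrightarrow> (f ^^ m) P \<in> curve a b"
  by (induction m) (auto simp: End_closed)

theorem corollary2p9:
  fixes a b :: "'k::{alg_closed_field, field_char_0}"
    and \<omega> \<omega>' :: "('k, 3) proj \<Rightarrow> ('k, 3) proj"
    and \<phi> \<phi>' :: "('k, 2) proj \<Rightarrow> ('k, 2) proj"
    and F :: "('f, 'v) ring_scheme"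
    and \<iota> :: "(('k, 3) proj \<Rightarrow> ('k, 3) proj) \<Rightarrow> 'f"
    and n k :: nat
  assumes "elliptic_curve a b"
    and "has_CM a b"
    and "is_fraction_field (End_ring a b) F \<iota>"
    and "\<omega> \<in> carrier (End_ring a b)"
    and "\<omega>' \<in> carrier (End_ring a b)"
    and "\<omega>' \<noteq> \<zero>\<^bsub>End_ring a b\<^esub>"
    and "induced_on_P1 a b \<omega> \<phi>"
    and "induced_on_P1 a b \<omega>' \<phi>'"
    and "k > 0"
  shows "((\<iota> \<omega> \<otimes>\<^bsub>F\<^esub> inv\<^bsub>F\<^esub> \<iota> \<omega>') [^]\<^bsub>F\<^esub> k = \<ominus>\<^bsub>F\<^esub> \<one>\<^bsub>F\<^esub> \<longrightarrow>
            preperiodic (map_prod \<phi> \<phi>') n k (diagonal UNIV) \<and>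
            \<not> preperiodic (map_prod \<omega> \<omega>') n k (diagonal (curve a b))) \<and>
         ((\<iota> \<omega> \<otimes>\<^bsub>F\<^esub> inv\<^bsub>F\<^esub> \<iota> \<omega>') [^]\<^bsub>F\<^esub> k = \<one>\<^bsub>F\<^esub> \<longrightarrow>
            preperiodic (map_prod \<omega> \<omega>') n k (diagonal (curve a b)) \<and>
            preperiodic (map_prod \<phi> \<phi>') n k (diagonal UNIV))"
proof -
  let ?E = "curve a b"
  note frac = assms(3) and \<omega> = assms(4) and \<omega>' = assms(5) and \<omega>'_nz = assms(6)
  note \<phi> = assms(7) and \<phi>' = assms(8)
  have surj': "\<omega>' ` ?E = ?E" by (rule End_surj[OF \<omega>' \<omega>'_nz \<phi>'])
  note power_relation = End_pow_quotient[OF frac \<omega> \<omega>' \<omega>'_nz, of _ k]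
  note projected = induced_diagonal_image[OF \<omega> \<phi> \<omega>' \<phi>']
  have commute: "(\<omega> ^^ n) ((\<omega>' ^^ n) P) = (\<omega>' ^^ n) ((\<omega> ^^ n) P)" if P: "P \<in> ?E" for P
    using End_commute[OF frac End_pow_closed[OF \<omega>, of n] End_pow_closed[OF \<omega>', of n] P]
    by (simp add: End_pow_apply[OF \<omega>] End_pow_apply[OF \<omega>'] End_pow_in_curve \<omega> \<omega>' P)
  let ?q = "(\<iota> \<omega> \<otimes>\<^bsub>F\<^esub> inv\<^bsub>F\<^esub> \<iota> \<omega>') [^]\<^bsub>F\<^esub> k"
  have minus: "preperiodic (map_prod \<phi> \<phi>') n k (diagonal UNIV) \<and>
      \<not> preperiodic (map_prod \<omega> \<omega>') n k (diagonal ?E)" if q: "?q = \<ominus>\<^bsub>F\<^esub> \<one>\<^bsub>F\<^esub>"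
  proof
    have shift: "(map_prod \<omega> \<omega>' ^^ (n + k)) ` diagonal ?E =
        (\<lambda>Q. ((\<omega> ^^ n) (ec_neg Q), (\<omega>' ^^ n) Q)) ` ?E"
      by (rule diagonal_image_shift) (use power_relation(2) q surj' in auto)
    have "pi_map ((\<omega> ^^ n) (ec_neg Q)) = pi_map ((\<omega> ^^ n) Q)" if "Q \<in> ?E" for Q
    proof -
      have "(\<omega> ^^ n) Q \<in> ?E" by (rule End_pow_in_curve[OF \<omega> that])
      then show ?thesis
        unfolding End_pow_neg[OF \<omega> that] by (metis pi_eq_iff ec_neg_in_curve)
    qed
    then show "preperiodic (map_prod \<phi> \<phi>') n k (diagonal UNIV)"
      unfolding preperiodic_def projected shift
      unfolding diagonal_image[where f = \<omega>] image_image
      by (intro image_cong refl) simp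
    obtain T where T: "T \<in> ?E" "ec_neg T \<noteq> T" by (rule exists_not_2_torsion)
    \<comment> \<open>Otherwise \<open>\<omega>\<^sup>k = 0\<close>, as \<open>k > 0\<close>, while \<open>\<omega>\<^sup>k = - \<omega>'\<^sup>k\<close> takes the value \<open>- T\<close>.\<close>
    have "\<omega> \<noteq> \<zero>\<^bsub>End_ring a b\<^esub>"
    proof
      assume zero: "\<omega> = \<zero>\<^bsub>End_ring a b\<^esub>"
      obtain P where P: "P \<in> ?E" "T = (\<omega>' ^^ k) P"
        using T(1) funpow_image_eq[OF surj', of k] by blast
      have "ec_neg T = (\<omega> ^^ k) P" using power_relation(2)[OF P(1) q] P by simp
      also have "\<dots> = \<omega> ((\<omega> ^^ (k - 1)) P)" using \<open>k > 0\<close> by (cases k) auto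
      also have "\<dots> = origin"
        using zero End_pow_in_curve[OF \<omega> P(1)] by (metis End_ring_sel(3) restrict_apply')
      finally show False using T ec_neg_neg[OF T(1)] by simp
    qed
    then have surj: "\<omega> ` ?E = ?E" by (rule End_surj[OF \<omega> _ \<phi>])
    show "\<not> preperiodic (map_prod \<omega> \<omega>') n k (diagonal ?E)"
    proof
      assume "preperiodic (map_prod \<omega> \<omega>') n k (diagonal ?E)"
      then have eq: "(\<lambda>Q. ((\<omega> ^^ n) (ec_neg Q), (\<omega>' ^^ n) Q)) ` ?E =
          (\<lambda>Q. ((\<omega> ^^ n) Q, (\<omega>' ^^ n) Q)) ` ?E"
        unfolding preperiodic_def shift unfolding diagonal_image .
      obtain R where R: "R \<in> ?E" "T = (\<omega> ^^ n) R"
        using T(1) funpow_image_eq[OF surj, of n] by blast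
      obtain Q where Q: "Q \<in> ?E" "R = (\<omega>' ^^ n) Q"
        using R(1) funpow_image_eq[OF surj', of n] by blast
      have "((\<omega> ^^ n) (ec_neg Q), (\<omega>' ^^ n) Q) \<in> (\<lambda>Q. ((\<omega> ^^ n) Q, (\<omega>' ^^ n) Q)) ` ?E"
        unfolding eq[symmetric] using Q(1) by (rule imageI)
      then obtain Q' where Q': "Q' \<in> ?E" "(\<omega> ^^ n) (ec_neg Q) = (\<omega> ^^ n) Q'"
        "(\<omega>' ^^ n) Q = (\<omega>' ^^ n) Q'"
        by auto
      have "ec_neg T = (\<omega>' ^^ n) ((\<omega> ^^ n) (ec_neg Q))"
        using R Q commute[OF Q(1)] \<omega> \<omega>' by (simp add: End_pow_neg End_pow_in_curve)
      also have "\<dots> = (\<omega> ^^ n) ((\<omega>' ^^ n) Q')" unfolding Q'(2) using commute[OF Q'(1)] by simp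
      also have "\<dots> = T" using R Q Q' by simp
      finally show False using T(2) by contradiction
    qed
  qed
  have plus: "preperiodic (map_prod \<omega> \<omega>') n k (diagonal ?E) \<and>
      preperiodic (map_prod \<phi> \<phi>') n k (diagonal UNIV)" if q: "?q = \<one>\<^bsub>F\<^esub>"
  proof -
    have "(map_prod \<omega> \<omega>' ^^ (n + k)) ` diagonal ?E = (\<lambda>Q. ((\<omega> ^^ n) Q, (\<omega>' ^^ n) Q)) ` ?E"
      by (rule diagonal_image_shift[where s = "\<lambda>Q. Q"]) (use power_relation(1) q surj' in auto)
    then have "(map_prod \<omega> \<omega>' ^^ (n + k)) ` diagonal ?E = (map_prod \<omega> \<omega>' ^^ n) ` diagonal ?E"
      unfolding diagonal_image .
    then show ?thesis unfolding preperiodic_def projected by simp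
  qed
  show ?thesis using minus plus by blast
qed

end
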